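(* Let $\lambda$ be a partition. For each ideal $I$ of $P_\lambda$, the order of $O_{p,I}$ is a monic polynomial in $p$ of degree $[I]$ with integer coefficients; that is, there is a monic polynomial $f\in\mathbf{Z}[t]$ of degree $[I]$, depending only on $\lambda$ and $I$, such that $|O_{p,I}|=f(p)$ for every prime $p$.
   Context: A partition is a non-increasing sequence $\lambda=(\lambda_1\geq\cdots\geq\lambda_l)$ of positive integers. For a prime $p$, $A_{p,\lambda}=\mathbf{Z}/p^{\lambda_1}\mathbf{Z}\oplus\cdots\oplus\mathbf{Z}/p^{\lambda_l}\mathbf{Z}$ and $G_{p,\lambda}$ is its automorphism group. Fundamental poset $P$: its elements are the symbols $(p^r,k)$ with integers $0\leq r<k$, where $(p^r,k)$ stands for the orbit of $p^r$ in $\mathbf{Z}/p^k\mathbf{Z}$ under automorphisms of $\mathbf{Z}/p^k\mathbf{Z}$, i.e. the set of elements $p^ru$ with $p\nmid u$. The partial order is: $(p^r,k)\geq(p^s,l)$ if and only if $r\leq s$ and $k-r\geq l-s$. Since the order depends only on the pairs $(r,k)$, the poset $P$ is regarded as independent of $p$ (identify $(p^r,k)$ with the pair $(r,k)$). $P_\lambda$ is the induced subposet consisting of the elements $(p^r,k)$ with $k=\lambda_i$ for some $i$; it too is independent of $p$. An ideal of a poset is a (possibly empty) down-closed subset. For $a=(a_1,\ldots,a_l)\in A_{p,\lambda}$, $I(a)$ is the ideal of $P$ generated by the orbits of the non-zero coordinates $a_i\in\mathbf{Z}/p^{\lambda_i}\mathbf{Z}$ ($a_i=p^ru\neq0$ with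 $p\nmid u$ contributes $(p^r,\lambda_i)$), and $I_\lambda(a)=I(a)\cap P_\lambda$. For an ideal $I$ of $P_\lambda$, $O_{p,I}=\{a\in A_{p,\lambda}: I_\lambda(a)=I\}$, which is the $G_{p,\lambda}$-orbit in $A_{p,\lambda}$ corresponding to $I$. For $x=(p^r,k)\in P_\lambda$, the multiplicity $m(x)$ is the number of times $k$ occurs in $\lambda$, and $[I]=\sum_{x\in I}m(x)$. *)

theory Defs
  imports "HOL-Algebra.Product_Groups" "HOL-Computational_Algebra.Computational_Algebra"
begin

definition is_partition :: "nat list \<Rightarrow> bool" where
  "is_partition lam \<longleftrightarrow> sorted_wrt (\<ge>) lam \<and> (\<forall>k\<in>set lam. 0 < k)"

text \<open>The parts of a partition are indexed from 0, and elements of \<open>\<int>/n\<int>\<close> are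
  represented by the integers in \<open>{0..<n}\<close>.\<close>

definition abelian_p_group :: "nat \<Rightarrow> nat list \<Rightarrow> (nat \<Rightarrow> int) monoid" where
  "abelian_p_group p lam = product_group {..<length lam} (\<lambda>i. integer_mod_group (p ^ (lam ! i)))"

text \<open>The symbol \<open>(p^r, k)\<close>, standing for the orbit of \<open>p^r\<close> in \<open>\<int>/p^k\<int>\<close> under
  automorphisms, is represented by the pair \<open>(r, k)\<close>, which makes the poset independent of \<open>p\<close>.\<close>

definition fundamental_poset :: "(nat \<times> nat) set" where
  "fundamental_poset = {(r, k). r < k}"

definition orbit_le :: "nat \<times> nat \<Rightarrow> nat \<times> nat \<Rightarrow> bool" where
  "orbit_le = (\<lambda>(s, l) (r, k). r \<le> s \<and> int l - int s \<le> int k - int r)"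

definition poset_of_partition :: "nat list \<Rightarrow> (nat \<times> nat) set" where
  "poset_of_partition lam = {(r, k) \<in> fundamental_poset. k \<in> set lam}"

definition ideal_of_poset :: "(nat \<times> nat) set \<Rightarrow> (nat \<times> nat) set \<Rightarrow> bool" where
  "ideal_of_poset Q I \<longleftrightarrow> I \<subseteq> Q \<and> (\<forall>x\<in>I. \<forall>y\<in>Q. orbit_le y x \<longrightarrow> y \<in> I)"

definition generated_ideal :: "(nat \<times> nat) set \<Rightarrow> (nat \<times> nat) set" where
  "generated_ideal S = {x \<in> fundamental_poset. \<exists>y\<in>S. orbit_le x y}"

text \<open>The orbits of the non-zero coordinates of \<open>a\<close>. Since \<open>a i \<noteq> 0\<close> forces \<open>r < lam ! i\<close>,
  this is a subset of the fundamental poset.\<close>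

definition coordinate_orbits :: "nat \<Rightarrow> nat list \<Rightarrow> (nat \<Rightarrow> int) \<Rightarrow> (nat \<times> nat) set" where
  "coordinate_orbits p lam a =
    {(r, lam ! i) | r i. i < length lam \<and> a i \<noteq> 0 \<and>
      (\<exists>u::int. \<not> int p dvd u \<and> a i = (int p ^ r * u) mod int p ^ (lam ! i))}"

definition element_ideal :: "nat \<Rightarrow> nat list \<Rightarrow> (nat \<Rightarrow> int) \<Rightarrow> (nat \<times> nat) set" where
  "element_ideal p lam a = generated_ideal (coordinate_orbits p lam a)"

definition orbit_of_ideal :: "nat \<Rightarrow> nat list \<Rightarrow> (nat \<times> nat) set \<Rightarrow> (nat \<Rightarrow> int) set" where
  "orbit_of_ideal p lam I =
    {a \<in> carrier (abelian_p_group p lam). element_ideal p lam a \<inter> poset_of_partition lam = I}"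

definition multiplicity_in :: "nat list \<Rightarrow> nat \<times> nat \<Rightarrow> nat" where
  "multiplicity_in lam x = count_list lam (snd x)"

definition ideal_weight :: "nat list \<Rightarrow> (nat \<times> nat) set \<Rightarrow> nat" where
  "ideal_weight lam I = (\<Sum>x\<in>I. multiplicity_in lam x)"

end

theory Submission
  imports Defs
begin

text \<open>The elements \<open>a\<close> with \<open>I\<^sub>\<lambda>(a) \<subseteq> I\<close> form a product over the parts \<open>k\<close> of \<open>\<lambda>\<close> of
  subgroups \<open>p^m \<int>/p^k\<int>\<close>, where \<open>(r, k) \<in> I\<close> iff \<open>m \<le> r < k\<close>; hence there are \<open>p^[I]\<close> of
  them. They are the disjoint union of the orbits of the ideals \<open>J \<subseteq> I\<close>, and \<open>[J] < [I]\<close> for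
  \<open>J \<noteq> I\<close>, so solving for the orbit of \<open>I\<close> gives the claim by induction on \<open>I\<close>.\<close>

lemma orbit_le_refl: "orbit_le x x"
  by (auto simp: orbit_le_def split: prod.splits)

lemma orbit_le_trans: "orbit_le x y \<Longrightarrow> orbit_le y z \<Longrightarrow> orbit_le x z"
  by (auto simp: orbit_le_def split: prod.splits)

text \<open>By transitivity of the order. It ensures that the orbits attached to ideals exhaust the
  group.\<close>

lemma ideal_of_poset_element_ideal:
  "ideal_of_poset (poset_of_partition lam) (element_ideal p lam a \<inter> poset_of_partition lam)"
  by (auto simp: ideal_of_poset_def element_ideal_def generated_ideal_def poset_of_partition_def
      intro: orbit_le_trans)

lemma finite_poset_of_partition: "finite (poset_of_partition lam)"
proof (rule finite_subset)
  show "poset_of_partition lam \<subseteq> (SIGMA k:set lam. {..<k})\<inverse>"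
    by (auto simp: poset_of_partition_def fundamental_poset_def)
qed (auto intro!: finite_SigmaI)

text \<open>A nonzero residue fixes its exponent \<open>r\<close> as a p-adic valuation, so the
  existential in \<open>coordinate_orbits\<close> can be traded for the function
  \<open>multiplicity\<close>.\<close>

lemma mod_prime_power_orbit_iff:
  fixes p k r :: nat and x :: int
  assumes p: "prime p" and x: "0 < x" "x < int p ^ k"
  shows "(\<exists>u. \<not> int p dvd u \<and> x = (int p ^ r * u) mod int p ^ k) \<longleftrightarrow> multiplicity (int p) x = r"
proof
  have p0: "int p \<noteq> 0" and unit: "\<not> is_unit (int p)"
    using p by (auto simp: prime_gt_0_nat dest: not_prime_unit)
  {
    assume "\<exists>u. \<not> int p dvd u \<and> x = (int p ^ r * u) mod int p ^ k"
    then obtain u where u: "\<not> int p dvd u" "x = (int p ^ r * u) mod int p ^ k"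
      by blast
    \<comment> \<open>Otherwise \<open>int p ^ r * u\<close> would reduce to 0, against
      \<open>0 < x\<close>.\<close>
    have "r < k"
    proof (rule ccontr)
      assume "\<not> r < k"
      then have "int p ^ k dvd int p ^ r * u"
        by (simp add: le_imp_power_dvd)
      then show False using u x by simp
    qed
    \<comment> \<open>Both powers divide the modulus, so reduction changes divisibility by neither
      of them.\<close>
    then have "int p ^ r dvd int p ^ k" "int p ^ Suc r dvd int p ^ k"
      by (auto intro!: le_imp_power_dvd simp del: power_Suc)
    then have "int p ^ r dvd x" "\<not> int p ^ Suc r dvd x"
      unfolding u(2) using u(1) p0 by (auto simp: dvd_mod_iff simp del: power_Suc)
        (simp add: mult.commute)
    then show "multiplicity (int p) x = r"
      by (rule multiplicity_eqI)
  next
    assume r: "multiplicity (int p) x = r"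
    obtain u where u: "x = int p ^ r * u" "\<not> int p dvd u"
      using multiplicity_decompose'[of x "int p"] x unit r by auto
    show "\<exists>u. \<not> int p dvd u \<and> x = (int p ^ r * u) mod int p ^ k"
      using u x by (intro exI[of _ u]) auto
  }
qed

lemma card_multiples_below_power:
  fixes p k m :: nat
  assumes "0 < p" "m \<le> k"
  shows "card {x \<in> {0..<int p ^ k}. int p ^ m dvd x} = p ^ (k - m)"
proof -
  have pk: "int p ^ k = int p ^ m * int p ^ (k - m)"
    using assms by (simp flip: power_add)
  have pos: "\<not> int p ^ m \<le> 0" using assms by (simp add: not_le)
  have "{x \<in> {0..<int p ^ k}. int p ^ m dvd x} = (\<lambda>y. int p ^ m * y) ` {0..<int p ^ (k - m)}"
    unfolding pk using assms pos by (auto simp: dvd_def zero_le_mult_iff)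
  moreover have "inj_on (\<lambda>y. int p ^ m * y) {0..<int p ^ (k - m)}"
    using assms by (auto simp: inj_on_def)
  ultimately show ?thesis
    by (simp add: card_image nat_power_eq)
qed

text \<open>For fixed \<open>k\<close> a larger \<open>r\<close> gives a smaller element, so a
  down-closed set meets this chain in a final segment of \<open>{..<k}\<close>. The value
  \<open>m = k\<close> stands for the empty segment.\<close>

lemma ideal_section:
  assumes I: "ideal_of_poset (poset_of_partition lam) I" and k: "k \<in> set lam"
  obtains m where "m \<le> k" "\<And>r. (r, k) \<in> I \<longleftrightarrow> m \<le> r \<and> r < k"
proof (cases "\<exists>r. (r, k) \<in> I")
  case False
  then show ?thesis using that[of k] by auto
next
  case True
  define m where "m = (LEAST r. (r, k) \<in> I)"
  have mI: "(m, k) \<in> I" unfolding m_def using True by (rule LeastI_ex)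
  have le: "m \<le> r" if "(r, k) \<in> I" for r unfolding m_def using that by (rule Least_le)
  have lt: "r < k" if "(r, k) \<in> I" for r
    using that I by (auto simp: ideal_of_poset_def poset_of_partition_def fundamental_poset_def)
  have up: "(r, k) \<in> I" if "m \<le> r" "r < k" for r
  proof -
    have "(r, k) \<in> poset_of_partition lam" "orbit_le (r, k) (m, k)"
      using that k by (auto simp: poset_of_partition_def fundamental_poset_def orbit_le_def)
    then show ?thesis using I mI by (auto simp: ideal_of_poset_def)
  qed
  show ?thesis
    by (rule that[of m]) (use mI le lt up in \<open>auto intro: less_imp_le\<close>)
qed

lemma card_coordinates_in_ideal:
  assumes p: "prime p" and I: "ideal_of_poset (poset_of_partition lam) I" and k: "k \<in> set lam"
  shows "card {x \<in> {0..<int p ^ k}. x \<noteq> 0 \<longrightarrow> (multiplicity (int p) x, k) \<in> I}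
    = p ^ card {r. (r, k) \<in> I}"
proof -
  obtain m where m: "m \<le> k" "\<And>r. (r, k) \<in> I \<longleftrightarrow> m \<le> r \<and> r < k"
    using ideal_section[OF I k] by blast
  have unit: "\<not> is_unit (int p)"
    using p by (auto dest: not_prime_unit)
  have "(multiplicity (int p) x, k) \<in> I \<longleftrightarrow> int p ^ m dvd x"
    if "x \<in> {0..<int p ^ k}" "x \<noteq> 0" for x
  proof -
    \<comment> \<open>So the valuation is below \<open>k\<close> automatically, and membership in
      the section reduces to the lower bound \<open>m\<close>. The residue 0 satisfies both
      conditions.\<close>
    have "\<not> int p ^ k dvd x"
      using that zdvd_imp_le[of "int p ^ k" x] by auto
    then show ?thesis
      using that unit by (simp add: m(2) power_dvd_iff_le_multiplicity)
  qed
  then have "{x \<in> {0..<int p ^ k}. x \<noteq> 0 \<longrightarrow> (multiplicity (int p) x, k) \<in> I}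
    = {x \<in> {0..<int p ^ k}. int p ^ m dvd x}"
    by auto
  moreover have "{r. (r, k) \<in> I} = {m..<k}"
    by (auto simp: m(2))
  ultimately show ?thesis
    using card_multiples_below_power[of p m k] p m(1) by (simp add: prime_gt_0_nat)
qed

lemma carrier_abelian_p_group:
  assumes "prime p"
  shows "carrier (abelian_p_group p lam) = (\<Pi>\<^sub>E i\<in>{..<length lam}. {0..<int p ^ (lam ! i)})"
  using assms by (auto simp: abelian_p_group_def carrier_integer_mod_group prime_gt_0_nat)

text \<open>As \<open>I\<close> is down-closed in the poset of \<open>lam\<close>, it contains the
  generated ideal there as soon as it contains the generators. This turns the inclusion into a
  separate condition on each coordinate.\<close>

lemma element_ideal_subset_iff:
  assumes p: "prime p"
    and I: "ideal_of_poset (poset_of_partition lam) I"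
    and a: "a \<in> carrier (abelian_p_group p lam)"
  shows "element_ideal p lam a \<inter> poset_of_partition lam \<subseteq> I \<longleftrightarrow>
    (\<forall>i<length lam. a i \<noteq> 0 \<longrightarrow> (multiplicity (int p) (a i), lam ! i) \<in> I)"
proof -
  have bounds: "0 \<le> a i" "a i < int p ^ (lam ! i)" if "i < length lam" for i
    using a that by (auto simp: carrier_abelian_p_group[OF p] PiE_iff)
  have orbits: "coordinate_orbits p lam a =
      {(multiplicity (int p) (a i), lam ! i) | i. i < length lam \<and> a i \<noteq> 0}" (is "_ = ?C")
  proof -
    have "i < length lam \<and> a i \<noteq> 0 \<and>
        (\<exists>u. \<not> int p dvd u \<and> a i = (int p ^ r * u) mod int p ^ (lam ! i)) \<longleftrightarrow>
        i < length lam \<and> a i \<noteq> 0 \<and> multiplicity (int p) (a i) = r" for i r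
    proof (intro conj_cong refl)
      assume "i < length lam" "a i \<noteq> 0"
      then show "(\<exists>u. \<not> int p dvd u \<and> a i = (int p ^ r * u) mod int p ^ (lam ! i)) \<longleftrightarrow>
          multiplicity (int p) (a i) = r"
        using bounds[of i] by (intro mod_prime_power_orbit_iff[OF p]) auto
    qed
    then show ?thesis
      unfolding coordinate_orbits_def by (simp only:) blast
  qed
  have unit: "\<not> is_unit (int p)"
    using p by (auto dest: not_prime_unit)
  \<comment> \<open>This puts the generators into the poset of \<open>lam\<close>, so they survive
    the intersection and the inclusion forces them into \<open>I\<close>.\<close>
  have "multiplicity (int p) (a i) < lam ! i" if "i < length lam" "a i \<noteq> 0" for i
  proof -
    have "\<not> int p ^ (lam ! i) dvd a i"
      using that bounds[of i] zdvd_imp_le[of "int p ^ (lam ! i)" "a i"] by auto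
    then show ?thesis
      using that unit by (simp add: power_dvd_iff_le_multiplicity)
  qed
  then have "?C \<subseteq> poset_of_partition lam"
    by (auto simp: poset_of_partition_def fundamental_poset_def)
  then have "element_ideal p lam a \<inter> poset_of_partition lam \<subseteq> I \<longleftrightarrow> ?C \<subseteq> I"
    using I orbit_le_refl
    unfolding element_ideal_def generated_ideal_def orbits ideal_of_poset_def poset_of_partition_def
    by blast
  also have "\<dots> \<longleftrightarrow> (\<forall>i<length lam. a i \<noteq> 0 \<longrightarrow> (multiplicity (int p) (a i), lam ! i) \<in> I)"
    by auto
  finally show ?thesis .
qed

text \<open>Double counting of the pairs \<open>(x, i)\<close> with \<open>x\<close> in
  \<open>I\<close> and \<open>lam ! i = snd x\<close>.\<close>

lemma ideal_weight_eq_sum_sections: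
  assumes "finite I"
  shows "ideal_weight lam I = (\<Sum>i<length lam. card {r. (r, lam ! i) \<in> I})"
proof -
  have "ideal_weight lam I = (\<Sum>x\<in>I. \<Sum>i<length lam. if lam ! i = snd x then 1 else 0)"
    by (simp add: ideal_weight_def multiplicity_in_def count_list_eq_length_filter
        length_filter_conv_card sum.If_cases Int_def eq_commute conj_commute)
  also have "\<dots> = (\<Sum>i<length lam. \<Sum>x\<in>I. if lam ! i = snd x then 1 else 0)"
    by (rule sum.swap)
  also have "\<dots> = (\<Sum>i<length lam. card {r. (r, lam ! i) \<in> I})"
  proof (rule sum.cong)
    fix i
    have "I \<inter> {x. lam ! i = snd x} = (\<lambda>r. (r, lam ! i)) ` {r. (r, lam ! i) \<in> I}"
      by force
    then show "(\<Sum>x\<in>I. if lam ! i = snd x then 1 else 0) = card {r. (r, lam ! i) \<in> I}"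
      using assms by (simp add: sum.If_cases card_image inj_on_def)
  qed simp
  finally show ?thesis .
qed

text \<open>With inclusion in place of equality the coordinates can be chosen independently, so the
  count is a product; the exponents add up to the weight.\<close>

lemma card_element_ideal_subset:
  assumes p: "prime p"
    and I: "ideal_of_poset (poset_of_partition lam) I"
  shows "card {a \<in> carrier (abelian_p_group p lam).
      element_ideal p lam a \<inter> poset_of_partition lam \<subseteq> I} = p ^ ideal_weight lam I"
proof -
  define X where "X = (\<lambda>i. {x \<in> {0..<int p ^ (lam ! i)}.
    x \<noteq> 0 \<longrightarrow> (multiplicity (int p) x, lam ! i) \<in> I})"
  have "{a \<in> carrier (abelian_p_group p lam).
      element_ideal p lam a \<inter> poset_of_partition lam \<subseteq> I} =
    {a \<in> carrier (abelian_p_group p lam).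
      \<forall>i<length lam. a i \<noteq> 0 \<longrightarrow> (multiplicity (int p) (a i), lam ! i) \<in> I}"
    by (intro Collect_cong conj_cong refl element_ideal_subset_iff[OF p I])
  also have "\<dots> = (\<Pi>\<^sub>E i\<in>{..<length lam}. X i)"
    unfolding carrier_abelian_p_group[OF p] X_def PiE_iff set_eq_iff mem_Collect_eq Ball_def
      lessThan_iff
    by blast
  finally have "card {a \<in> carrier (abelian_p_group p lam).
      element_ideal p lam a \<inter> poset_of_partition lam \<subseteq> I} = (\<Prod>i<length lam. card (X i))"
    by (simp add: card_PiE)
  also have "\<dots> = (\<Prod>i<length lam. p ^ card {r. (r, lam ! i) \<in> I})"
    unfolding X_def by (intro prod.cong card_coordinates_in_ideal[OF p I]) auto
  also have "\<dots> = p ^ ideal_weight lam I"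
    using I finite_subset[OF _ finite_poset_of_partition]
    by (subst ideal_weight_eq_sum_sections) (auto simp: ideal_of_poset_def power_sum)
  finally show ?thesis .
qed

lemma card_element_ideal_subset_eq_sum:
  assumes p: "prime p" and I: "ideal_of_poset (poset_of_partition lam) I"
  shows "card {a \<in> carrier (abelian_p_group p lam).
      element_ideal p lam a \<inter> poset_of_partition lam \<subseteq> I}
    = (\<Sum>J | J \<subseteq> I \<and> ideal_of_poset (poset_of_partition lam) J. card (orbit_of_ideal p lam J))"
proof -
  have fin: "finite (carrier (abelian_p_group p lam))"
    unfolding carrier_abelian_p_group[OF p] by (intro finite_PiE) auto
  have finI: "finite I"
    using I finite_subset[OF _ finite_poset_of_partition] by (auto simp: ideal_of_poset_def)
  have "{a \<in> carrier (abelian_p_group p lam).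
      element_ideal p lam a \<inter> poset_of_partition lam \<subseteq> I}
    = (\<Union>J\<in>{J. J \<subseteq> I \<and> ideal_of_poset (poset_of_partition lam) J}. orbit_of_ideal p lam J)"
    using ideal_of_poset_element_ideal by (auto simp: orbit_of_ideal_def)
  \<comment> \<open>The union is disjoint because \<open>a\<close> determines
    \<open>J\<close>.\<close>
  then show ?thesis
    using fin finI by (simp add: card_UN_disjoint orbit_of_ideal_def disjoint_iff)
qed

text \<open>An element of \<open>I - J\<close> has a part of \<open>lam\<close> as second component,
  so its multiplicity is positive.\<close>

lemma ideal_weight_strict_mono:
  assumes "J \<subset> I" and "I \<subseteq> poset_of_partition lam"
  shows "ideal_weight lam J < ideal_weight lam I"
proof -
  obtain x where x: "x \<in> I - J" using assms(1) by blast
  have "0 < multiplicity_in lam x"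
    using x assms(2) count_list_0_iff[of lam "snd x"]
    by (auto simp: multiplicity_in_def poset_of_partition_def intro!: gr0I)
  then show ?thesis
    unfolding ideal_weight_def using assms x finite_subset[OF assms(2) finite_poset_of_partition]
    by (intro sum_strict_mono2[where b = x]) auto
qed

text \<open>The hypotheses are weaker than \<open>degree q < n\<close> so as to admit
  \<open>n = 0\<close> with \<open>q = 0\<close>. This case occurs for the empty ideal, where the
  sum over smaller ideals is empty.\<close>

lemma monic_monom_diff:
  fixes q :: "'a::comm_ring_1 poly"
  assumes "degree q \<le> n" "coeff q n = 0"
  shows "lead_coeff (monom 1 n - q) = 1" "degree (monom 1 n - q) = n"
proof -
  have c: "coeff (monom 1 n - q) n = 1" using assms by simp
  show "degree (monom 1 n - q) = n"
    using assms(1) c by (intro antisym degree_diff_le degree_monom_le le_degree) auto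
  with c show "lead_coeff (monom 1 n - q) = 1" by simp
qed

theorem theorem8p1:
  fixes lam :: "nat list" and I :: "(nat \<times> nat) set"
  assumes "is_partition lam"
    and "ideal_of_poset (poset_of_partition lam) I"
  shows "\<exists>f :: int poly. lead_coeff f = 1 \<and> degree f = ideal_weight lam I \<and>
    (\<forall>p::nat. prime p \<longrightarrow> int (card (orbit_of_ideal p lam I)) = poly f (int p))"
proof -
  have "finite I"
    using assms(2) finite_subset[OF _ finite_poset_of_partition] by (auto simp: ideal_of_poset_def)
  then show ?thesis using assms(2)
  proof (induction I rule: finite_psubset_induct)
    case (psubset I)
    let ?ideal = "ideal_of_poset (poset_of_partition lam)"
    let ?n = "ideal_weight lam I"
    define L where "L = {J. J \<subset> I \<and> ?ideal J}"
    have "\<forall>J\<in>L. \<exists>f :: int poly. degree f = ideal_weight lam J \<and>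
        (\<forall>p::nat. prime p \<longrightarrow> int (card (orbit_of_ideal p lam J)) = poly f (int p))"
      using psubset.IH by (auto simp: L_def)
    \<comment> \<open>The polynomials are chosen before any prime is fixed, so the same ones serve
      all primes.\<close>
    then obtain f :: "(nat \<times> nat) set \<Rightarrow> int poly" where f:
      "\<And>J. J \<in> L \<Longrightarrow> degree (f J) = ideal_weight lam J"
      "\<And>J p. J \<in> L \<Longrightarrow> prime p \<Longrightarrow> int (card (orbit_of_ideal p lam J)) = poly (f J) (int p)"
      by metis
    have finL: "finite L"
      using psubset.hyps by (auto simp: L_def intro: finite_subset[of _ "Pow I"])
    have deg: "degree (f J) < ?n" if "J \<in> L" for J
      using that psubset.prems f(1)[OF that]
      by (auto simp: L_def ideal_of_poset_def intro: ideal_weight_strict_mono)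
    have "degree (\<Sum>J\<in>L. f J) \<le> ?n"
      using finL deg by (intro degree_sum_le) (auto intro: less_imp_le)
    moreover have "coeff (\<Sum>J\<in>L. f J) ?n = 0"
      using deg by (simp add: coeff_sum coeff_eq_0)
    moreover have "int (card (orbit_of_ideal p lam I)) = poly (monom 1 ?n - (\<Sum>J\<in>L. f J)) (int p)"
      if p: "prime p" for p
    proof -
      have "{J. J \<subseteq> I \<and> ?ideal J} = insert I L" "I \<notin> L"
        using psubset.prems by (auto simp: L_def)
      \<comment> \<open>The two counts of the same set are equated, with the term
        \<open>J = I\<close> split off; over the integers the equation is then solved for that
        term.\<close>
      then have "p ^ ?n = card (orbit_of_ideal p lam I) + (\<Sum>J\<in>L. card (orbit_of_ideal p lam J))"
        using card_element_ideal_subset[OF p psubset.prems]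
          card_element_ideal_subset_eq_sum[OF p psubset.prems] finL by simp
      then have "int p ^ ?n = int (card (orbit_of_ideal p lam I))
          + (\<Sum>J\<in>L. int (card (orbit_of_ideal p lam J)))"
        by (simp flip: of_nat_power of_nat_sum of_nat_add)
      then show ?thesis
        using f(2) p by (simp add: poly_monom poly_sum)
    qed
    ultimately show ?case
      using monic_monom_diff[of "\<Sum>J\<in>L. f J" ?n] by blast
  qed
qed

end
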